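(* Let $K$ be a field of characteristic $p>0$ and let $\delta$ be a nonzero $\mathcal{E}$-derivation of $K[x_1]$. Then $\operatorname{Im}\delta$ is a Mathieu-Zhao space of $K[x_1]$ if and only if $\delta$ is not locally nilpotent.
   Context: An $\mathcal{E}$-derivation of $K[x_1]$ is a $K$-linear map $\delta:K[x_1]\to K[x_1]$ with $\delta(ab)=\delta(a)b+a\delta(b)-\delta(a)\delta(b)$ for all $a,b\in K[x_1]$; equivalently, $\delta=I-\phi$ where $I$ is the identity map and $\phi$ is a $K$-algebra endomorphism of $K[x_1]$. $\operatorname{Im}\delta=\delta(K[x_1])$. A $K$-linear endomorphism $\eta$ of $K[x_1]$ is locally nilpotent if for each $a\in K[x_1]$ there exists $m\geq1$ with $\eta^m(a)=0$. A $K$-subspace $M$ of $K[x_1]$ is a Mathieu-Zhao space of $K[x_1]$ if for any $a,b\in K[x_1]$ with $a^m\in M$ for all $m\geq 1$, one has $ba^m\in M$ for all sufficiently large $m$. *)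

theory Defs
  imports "HOL-Computational_Algebra.Computational_Algebra"
begin

text \<open>
  The polynomial ring \<open>K[x\<^sub>1]\<close> over a field \<open>K\<close> is the type \<open>'a poly\<close> with \<open>'a\<close> of
  class \<open>field\<close>; its \<open>K\<close>-vector space structure is given by the scalar multiplication
  \<^const>\<open>smult\<close>.
\<close>

lemma vector_space_smult: "vector_space (smult :: 'a::field \<Rightarrow> 'a poly \<Rightarrow> 'a poly)"
  by unfold_locales (simp_all add: smult_add_right smult_add_left)

text \<open>
  The product rule of an \<open>\<E>\<close>-derivation gives \<open>\<delta> 1 \<in> {0, 1}\<close>, and \<open>\<delta> 1 = 1\<close> happens only
  for \<open>\<delta> = id\<close>. So in the description \<open>\<delta> = id - \<phi>\<close> the multiplicative \<open>K\<close>-linear map \<open>\<phi>\<close> is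
  either unital or zero; the case \<open>\<phi> = 0\<close> is included here.
\<close>

definition E_derivation :: "('a::field poly \<Rightarrow> 'a poly) \<Rightarrow> bool" where
  "E_derivation \<delta> \<longleftrightarrow>
     Vector_Spaces.linear smult smult \<delta> \<and>
     (\<forall>a b. \<delta> (a * b) = \<delta> a * b + a * \<delta> b - \<delta> a * \<delta> b)"

definition locally_nilpotent :: "('a::field poly \<Rightarrow> 'a poly) \<Rightarrow> bool" where
  "locally_nilpotent \<eta> \<longleftrightarrow>
     Vector_Spaces.linear smult smult \<eta> \<and>
     (\<forall>a. \<exists>m\<ge>1. (\<eta> ^^ m) a = 0)"

definition Mathieu_Zhao_space :: "'a::field poly set \<Rightarrow> bool" where
  "Mathieu_Zhao_space M \<longleftrightarrow>
     module.subspace smult M \<and>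
     (\<forall>a b. (\<forall>m\<ge>1. a ^ m \<in> M) \<longrightarrow> (\<forall>\<^sub>F m in sequentially. b * a ^ m \<in> M))"

end

theory Submission
  imports Defs
begin

text \<open>
  An \<open>\<E>\<close>-derivation \<open>\<delta>\<close> is \<open>id - \<phi>\<close> with \<open>\<phi>\<close> linear and multiplicative. If \<open>\<phi> 1 = 0\<close>, then
  \<open>\<delta> = id\<close> and everything is clear. Otherwise \<open>\<delta> u = u - u \<circ> f\<close> for \<open>f = \<phi> x\<close>, and the question
  becomes one about the dynamics of \<open>f\<close>. Write \<open>f\<^sup>n\<close> for the \<open>n\<close>-th iterate of \<open>f\<close> and \<open>M\<close> for
  the image of \<open>\<delta>\<close>.

  The main tool is the orbit sum \<open>u + u \<circ> f + \<dots> + u \<circ> f\<^sup>n\<^sup>-\<^sup>1\<close>. On \<open>u = h - h \<circ> f\<close> it telescopes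
  to \<open>h - h \<circ> f\<^sup>n\<close>, which is a multiple of \<open>F = f\<^sup>n - x\<close>. So if every power of \<open>g\<close> lies in \<open>M\<close>,
  then modulo \<open>F\<close> all power sums of the \<open>n\<close> elements \<open>g \<circ> f\<^sup>i\<close> vanish, and Newton's identities
  give that \<open>F\<close> divides \<open>n\<close> times their product (\<open>dvd_orbit_prod\<close>). Taking \<open>n\<close> prime to the
  characteristic removes the factor \<open>n\<close>.

  If \<open>deg f \<ge> 2\<close>, this forces \<open>g = 0\<close> by counting degrees. Modulo \<open>F\<close>, composition with \<open>f\<close> is an
  automorphism, because its \<open>n\<close>-th power is the identity; hence the common divisors of \<open>F\<close> with
  \<open>g \<circ> f\<^sup>i\<close> are no larger than those with \<open>g\<close>, so their degree is at most \<open>deg g\<close>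
  (\<open>degree_le_of_dvd_pcompose\<close>). Thus a nonzero \<open>g\<close> would give \<open>(deg f)\<^sup>n = deg F \<le> n \<cdot> deg g\<close>,
  which is false for large \<open>n\<close>. A subspace in which only \<open>0\<close> has all its powers is trivially a
  Mathieu-Zhao space, and \<open>\<delta>\<close> is not locally nilpotent since it raises degrees.

  If \<open>f = a x + b\<close> with \<open>a \<noteq> 1\<close>, then \<open>f\<close> has a fixed point \<open>c\<close>, and \<open>(x - c)\<^sup>n\<close> is an eigenvector
  of \<open>\<delta>\<close> with eigenvalue \<open>1 - a\<^sup>n\<close>; so \<open>\<delta>\<close> is not locally nilpotent. If \<open>a\<close> is a root of unity,
  then \<open>f\<^sup>n = x\<close> for some \<open>n\<close> prime to the characteristic, so \<open>F = 0\<close> and the product of the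
  \<open>g \<circ> f\<^sup>i\<close> vanishes; again \<open>g = 0\<close>. If \<open>a\<close> is not a root of unity (for instance \<open>a = 0\<close>), then \<open>M\<close>
  is the ideal generated by \<open>x - c\<close>.

  The remaining case is the translation \<open>f = x + b\<close> with \<open>b \<noteq> 0\<close>. It lowers degrees, so \<open>\<delta>\<close> is locally
  nilpotent. As \<open>1 \<in> M\<close>, the image could only be a Mathieu-Zhao space if it were everything; but in
  characteristic \<open>p\<close> one has \<open>f\<^sup>p = x\<close>, so the orbit sum of length \<open>p\<close> kills \<open>M\<close>, whereas it does
  not kill a polynomial that vanishes at \<open>b, 2 b, \<dots>, (p - 1) b\<close> but not at \<open>0\<close>.
\<close>

section \<open>\<open>\<E>\<close>-derivations as differences with a composition operator\<close>

interpretation poly_vs: vector_space "smult :: 'a::field \<Rightarrow> 'a poly \<Rightarrow> 'a poly"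
  by (rule vector_space_smult)

lemma linear_smultI:
  assumes "\<And>u v. \<delta> (u + v) = \<delta> u + \<delta> v" "\<And>c u. \<delta> (smult c u) = smult c (\<delta> u)"
  shows "Vector_Spaces.linear smult smult (\<delta> :: 'a::field poly \<Rightarrow> 'a poly)"
  by unfold_locales (use assms in \<open>simp_all add: smult_add_right smult_add_left\<close>)

lemma multiplicative_linear_eq_pcompose:
  fixes \<phi> :: "'a::field poly \<Rightarrow> 'a poly"
  assumes add: "\<And>u v. \<phi> (u + v) = \<phi> u + \<phi> v"
    and scale: "\<And>c u. \<phi> (smult c u) = smult c (\<phi> u)"
    and mult: "\<And>u v. \<phi> (u * v) = \<phi> u * \<phi> v"
    and one: "\<phi> 1 = 1"
  shows "\<phi> u = u \<circ>\<^sub>p \<phi> [:0, 1:]"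
proof (induction u)
  case 0
  show ?case using scale[of 0 0] by simp
next
  case (pCons a u)
  have "pCons a u = smult a 1 + [:0, 1:] * u" by simp
  then have "\<phi> (pCons a u) = smult a 1 + \<phi> [:0, 1:] * \<phi> u"
    by (metis add scale mult one)
  then show ?case by (simp add: pCons pcompose_pCons one_pCons)
qed

lemma E_derivation_cases:
  fixes \<delta> :: "'a::field poly \<Rightarrow> 'a poly"
  assumes "E_derivation \<delta>"
  obtains (id) "\<delta> = (\<lambda>u. u)"
  | (pcompose) f where "\<delta> = (\<lambda>u. u - u \<circ>\<^sub>p f)"
proof -
  from assms have "Vector_Spaces.linear smult smult \<delta>"
    and prod: "\<And>u v. \<delta> (u * v) = \<delta> u * v + u * \<delta> v - \<delta> u * \<delta> v"
    by (auto simp: E_derivation_def)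
  then interpret \<delta>: Vector_Spaces.linear smult smult \<delta> by simp
  define \<phi> where "\<phi> = (\<lambda>u. u - \<delta> u)"
  have \<delta>: "\<delta> u = u - \<phi> u" for u by (simp add: \<phi>_def)
  have add: "\<phi> (u + v) = \<phi> u + \<phi> v" for u v by (simp add: \<phi>_def \<delta>.add)
  have scale: "\<phi> (smult c u) = smult c (\<phi> u)" for c u
    by (simp add: \<phi>_def \<delta>.scale smult_diff_right)
  have mult: "\<phi> (u * v) = \<phi> u * \<phi> v" for u v
    by (simp add: \<phi>_def prod algebra_simps)
  have "\<phi> 1 * (\<phi> 1 - 1) = 0" using mult[of 1 1] by (simp add: algebra_simps)
  then consider "\<phi> 1 = 0" | "\<phi> 1 = 1" by fastforce
  then show thesis
  proof cases
    case 1
    then have "\<phi> u = 0" for u using mult[of 1 u] by simp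
    then show ?thesis using id \<delta> by auto
  next
    case 2
    then have "\<phi> u = u \<circ>\<^sub>p \<phi> [:0, 1:]" for u
      using multiplicative_linear_eq_pcompose[of \<phi>] add scale mult by blast
    then have "\<delta> u = u - u \<circ>\<^sub>p \<phi> [:0, 1:]" for u by (metis \<delta>)
    then show ?thesis using pcompose by blast
  qed
qed

lemma linear_diff_pcompose:
  "Vector_Spaces.linear smult smult (\<lambda>u. u - u \<circ>\<^sub>p (f :: 'a::field poly))"
  by (rule linear_smultI) (simp_all add: pcompose_add pcompose_smult smult_diff_right)

lemma subspace_range_diff_pcompose:
  "module.subspace smult (range (\<lambda>u. u - u \<circ>\<^sub>p (f :: 'a::field poly)))"
proof -
  interpret \<delta>: Vector_Spaces.linear smult smult "\<lambda>u. u - u \<circ>\<^sub>p f"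
    by (rule linear_diff_pcompose)
  show ?thesis using \<delta>.subspace_image[OF poly_vs.subspace_UNIV] .
qed

section \<open>Divisibility of polynomials\<close>

lemma pcompose_power: "(u ^ n) \<circ>\<^sub>p v = (u \<circ>\<^sub>p v) ^ n" for u v :: "'a::comm_semiring_1 poly"
  by (induction n) (simp_all add: pcompose_1 pcompose_mult)

lemma pcompose_monom: "monom c n \<circ>\<^sub>p v = smult c (v ^ n)" for v :: "'a::comm_semiring_1 poly"
  by (simp add: monom_altdef pcompose_smult pcompose_power pcompose_pCons)

text \<open>
  This is Newton's identity of index \<open>card I\<close>, read modulo \<open>F\<close>: the \<open>g i\<close> are roots of
  \<open>P = (\<Prod>i\<in>I. t - g i)\<close>, so summing \<open>P (g i) = 0\<close> over \<open>i\<close> expresses \<open>card I\<close> times the constant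
  coefficient of \<open>P\<close> through the power sums of positive index.
\<close>

lemma dvd_power_sum_imp_dvd_prod:
  fixes g :: "'b \<Rightarrow> 'a::comm_ring_1"
  assumes "finite I" and F: "\<And>m. m \<ge> 1 \<Longrightarrow> F dvd (\<Sum>i\<in>I. g i ^ m)"
  shows "F dvd of_nat (card I) * (\<Prod>i\<in>I. g i)"
proof -
  define P where "P = (\<Prod>i\<in>I. [:- g i, 1:])"
  have root: "poly P (g i) = 0" if "i \<in> I" for i
    using that \<open>finite I\<close> by (auto simp: P_def poly_prod intro!: prod_zero)
  have P0: "coeff P 0 = (-1) ^ card I * (\<Prod>i\<in>I. g i)"
    unfolding P_def by (simp add: poly_0_coeff_0[symmetric] poly_prod prod_uminus)
  have "0 = (\<Sum>i\<in>I. poly P (g i))" by (simp add: root)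
  also have "\<dots> = (\<Sum>k\<le>degree P. coeff P k * (\<Sum>i\<in>I. g i ^ k))"
    unfolding poly_altdef sum_distrib_left by (rule sum.swap)
  also have "\<dots> = coeff P 0 * of_nat (card I)
      + (\<Sum>k\<in>{1..degree P}. coeff P k * (\<Sum>i\<in>I. g i ^ k))"
    by (subst sum.remove[of _ 0]) (auto intro!: sum.cong)
  finally have "coeff P 0 * of_nat (card I)
      = - (\<Sum>k\<in>{1..degree P}. coeff P k * (\<Sum>i\<in>I. g i ^ k))"
    by (simp add: eq_neg_iff_add_eq_0)
  also have "F dvd \<dots>"
    unfolding dvd_minus_iff by (intro dvd_sum dvd_mult F) simp
  finally have "F dvd (-1) ^ card I * (of_nat (card I) * (\<Prod>i\<in>I. g i))"
    by (simp add: P0 algebra_simps)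
  then show ?thesis
    by (cases "even (card I)") simp_all
qed

text \<open>
  The witness \<open>D\<close> is a greatest common divisor of \<open>F\<close> and \<open>a\<close>, found as a nonzero element of least
  degree in the ideal that they generate. Its Bezout representation \<open>D = u * F + v * a\<close> shows that \<open>F\<close>
  divides \<open>D * b\<close>, so the cofactor \<open>E = F / D\<close> divides \<open>b\<close>.
\<close>

lemma poly_dvd_mult_split:
  fixes F a b :: "'a::field poly"
  assumes "F dvd a * b" "F \<noteq> 0"
  obtains D E where "F = D * E" "D dvd a" "E dvd b"
proof -
  define J where "J = {u * F + v * a |u v. True}"
  have diff: "w - q * z \<in> J" if "w \<in> J" "z \<in> J" for w z q
  proof -
    from that obtain u v u' v' where "w = u * F + v * a" "z = u' * F + v' * a"
      by (auto simp: J_def)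
    then have "w - q * z = (u - q * u') * F + (v - q * v') * a" by (simp add: algebra_simps)
    then show ?thesis unfolding J_def by blast
  qed
  have F: "F \<in> J" unfolding J_def by (rule CollectI, rule exI[of _ 1], rule exI[of _ 0]) simp
  have a: "a \<in> J" unfolding J_def by (rule CollectI, rule exI[of _ 0], rule exI[of _ 1]) simp
  obtain D where D: "D \<in> J" "D \<noteq> 0"
    and min: "\<And>w. w \<in> J \<Longrightarrow> w \<noteq> 0 \<Longrightarrow> degree D \<le> degree w"
    using ex_has_least_nat[of "\<lambda>w. w \<in> J \<and> w \<noteq> 0" F degree] F \<open>F \<noteq> 0\<close> by blast
  have dvd: "D dvd w" if "w \<in> J" for w
  proof -
    have "w mod D \<in> J"
      using diff[OF that D(1), of "w div D"] by (simp add: minus_div_mult_eq_mod)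
    then have "w mod D = 0" using min[of "w mod D"] degree_mod_less'[OF D(2), of w] by fastforce
    then show ?thesis by auto
  qed
  obtain E where E: "F = D * E" using dvd[OF F] by blast
  obtain u v where "D = u * F + v * a" using D(1) by (auto simp: J_def)
  then have "D * b = F * (u * b) + v * (a * b)" by (simp add: algebra_simps)
  moreover have "F dvd F * (u * b) + v * (a * b)"
    by (rule dvd_add[OF dvd_triv_left dvd_mult[OF assms(1)]])
  ultimately have "D * E dvd D * b" by (simp add: E)
  then have "E dvd b" using D(2) by simp
  then show thesis using that E dvd[OF a] by blast
qed

text \<open>
  A divisor of a product is a product of divisors of the factors.
\<close>

lemma degree_le_of_dvd_prod:
  fixes F :: "'a::field poly"
  assumes "finite I" "F \<noteq> 0" "F dvd (\<Prod>i\<in>I. g i)"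
    and "\<And>D i. i \<in> I \<Longrightarrow> D dvd F \<Longrightarrow> D dvd g i \<Longrightarrow> degree D \<le> r"
  shows "degree F \<le> card I * r"
  using assms
proof (induction I arbitrary: F rule: finite_induct)
  case empty
  then show ?case by (auto simp: is_unit_iff_degree)
next
  case (insert j I)
  then have "F dvd g j * (\<Prod>i\<in>I. g i)" by simp
  then obtain D E where DE: "F = D * E" "D dvd g j" "E dvd (\<Prod>i\<in>I. g i)"
    using poly_dvd_mult_split insert.prems(1) by metis
  then have "degree D \<le> r" using insert.prems(3)[of j D] by simp
  moreover have "degree E \<le> card I * r"
  proof (rule insert.IH)
    show "E \<noteq> 0" using DE(1) insert.prems(1) by auto
    show "degree D' \<le> r" if "i \<in> I" "D' dvd E" "D' dvd g i" for D' i
      using insert.prems(3)[of i D'] that DE(1) by simp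
  qed (rule DE(3))
  ultimately show ?case
    using DE(1) insert.hyps insert.prems(1) by (simp add: degree_mult_eq)
qed

lemma poly_mod_sum_left: "(\<Sum>i\<in>A. u i) mod D = (\<Sum>i\<in>A. u i mod (D :: 'a::field poly))"
  by (induction A rule: infinite_finite_induct) (simp_all add: poly_mod_add_left)

text \<open>
  The first hypothesis says that modulo \<open>D\<close> the element \<open>y\<close> generates \<open>K[x]\<close> as an algebra, since \<open>x\<close>
  itself is the polynomial \<open>v\<close> in \<open>y\<close>. The second says that \<open>y\<close> is a root of \<open>g\<close> there. So the
  powers of \<open>y\<close> below \<open>deg g\<close> span the quotient \<open>K[x]/(D)\<close>, whose dimension is \<open>deg D\<close>. The quotient is
  represented by remainders, and it suffices to compare the spanning set with the \<open>deg g + 1\<close>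
  independent monomials that would exist if \<open>deg D\<close> were larger than \<open>deg g\<close>.
\<close>

lemma degree_le_of_dvd_pcompose:
  fixes D g v y :: "'a::field poly"
  assumes gen: "D dvd v \<circ>\<^sub>p y - [:0, 1:]" and g: "D dvd g \<circ>\<^sub>p y" "g \<noteq> 0"
  shows "degree D \<le> degree g"
proof (rule ccontr)
  assume "\<not> degree D \<le> degree g"
  then have less: "degree g < degree D" by simp
  define r where "r = degree g"
  define S where "S = (\<lambda>j. monom 1 j :: 'a poly) ` {..r}"
  define T where "T = (\<lambda>k. y ^ k mod D) ` {..<r}"
  have inj: "inj_on (\<lambda>j. monom 1 j :: 'a poly) {..r}"
    by (auto intro!: inj_onI simp: monom_eq_iff')
  have "poly_vs.independent S"
  proof (rule poly_vs.independent_if_scalars_zero)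
    fix c w assume zero: "(\<Sum>x\<in>S. smult (c x) x) = 0" and "w \<in> S"
    then obtain j where j: "j \<le> r" "w = monom 1 j" by (auto simp: S_def)
    have "0 = coeff (\<Sum>x\<in>S. smult (c x) x) j" by (simp add: zero)
    also have "\<dots> = (\<Sum>i\<le>r. c (monom 1 i) * coeff (monom 1 i) j)"
      unfolding S_def by (subst sum.reindex[OF inj]) (simp add: coeff_sum)
    also have "\<dots> = c w" using j by (subst sum.remove[of _ j]) auto
    finally show "c w = 0" by simp
  qed (simp add: S_def)
  moreover have "S \<subseteq> poly_vs.span T"
  proof
    fix w assume "w \<in> S"
    then obtain j where j: "j \<le> r" "w = monom 1 j" by (auto simp: S_def)
    \<comment> \<open>Modulo \<open>D\<close>, \<open>w = x\<^sup>j\<close> is \<open>v\<^sup>j\<close> evaluated at \<open>y\<close>, where \<open>v\<^sup>j\<close> may be reduced modulo \<open>g\<close>.\<close>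
    define u where "u = v ^ j mod g"
    have u: "coeff u k = 0" if "k \<ge> r" for k
    proof (cases "u = 0")
      case False
      then have "degree u < r" using degree_mod_less'[OF g(2)] by (simp add: u_def r_def)
      then show ?thesis using that by (intro coeff_eq_0) simp
    qed simp
    have "u = v ^ j - g * (v ^ j div g)" by (simp add: u_def minus_mult_div_eq_mod)
    then have "u \<circ>\<^sub>p y = (v \<circ>\<^sub>p y) ^ j - g \<circ>\<^sub>p y * ((v ^ j div g) \<circ>\<^sub>p y)"
      by (simp add: pcompose_diff pcompose_mult pcompose_power)
    then have "u \<circ>\<^sub>p y mod D = (v \<circ>\<^sub>p y) ^ j mod D"
      using g(1) by (simp add: poly_mod_diff_left)
    also have "\<dots> = [:0, 1:] ^ j mod D"
      using gen by (metis mod_eq_dvd_iff power_mod)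
    also have "[:0, 1:] ^ j = w" by (simp add: j monom_altdef)
    also have "w mod D = w" using j less by (simp add: mod_poly_less degree_monom_eq r_def)
    finally have "w = u \<circ>\<^sub>p y mod D" ..
    also have "u = (\<Sum>k<r. monom (coeff u k) k)"
      by (rule poly_eqI) (auto simp: coeff_sum u not_less)
    also have "\<dots> \<circ>\<^sub>p y mod D = (\<Sum>k<r. smult (coeff u k) (y ^ k mod D))"
      by (simp add: pcompose_sum pcompose_monom poly_mod_sum_left mod_smult_left)
    also have "\<dots> \<in> poly_vs.span T"
      by (intro poly_vs.span_sum poly_vs.span_scale poly_vs.span_base) (auto simp: T_def)
    finally show "w \<in> poly_vs.span T" .
  qed
  ultimately have "card S \<le> card T"
    using poly_vs.independent_span_bound[of T S] by (simp add: T_def)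
  moreover have "card S = Suc r" unfolding S_def by (simp add: card_image[OF inj])
  moreover have "card T \<le> r" unfolding T_def by (metis card_image_le card_lessThan finite_lessThan)
  ultimately show False by simp
qed

section \<open>Iterates and orbit sums\<close>

primrec pcompose_iter :: "'a::comm_semiring_1 poly \<Rightarrow> nat \<Rightarrow> 'a poly" where
  "pcompose_iter f 0 = [:0, 1:]"
| "pcompose_iter f (Suc n) = pcompose_iter f n \<circ>\<^sub>p f"

lemma pcompose_iter_add:
  "pcompose_iter f (m + n) = pcompose_iter f m \<circ>\<^sub>p pcompose_iter f n"
  by (induction n) (simp_all add: pcompose_assoc)

lemma degree_pcompose_iter:
  "degree (pcompose_iter f n) = degree (f :: 'a::idom poly) ^ n"
  by (induction n) (simp_all add: degree_pcompose mult.commute)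

lemma pcompose_minus_self_dvd:
  fixes u w :: "'a::comm_ring_1 poly"
  shows "w - [:0, 1:] dvd u \<circ>\<^sub>p w - u"
proof (induction u)
  case (pCons a u)
  have "pCons a u \<circ>\<^sub>p w - pCons a u = w * (u \<circ>\<^sub>p w - u) + (w - [:0, 1:]) * u"
  proof -
    have "pCons a u = [:a:] + [:0, 1:] * u" by simp
    then show ?thesis unfolding pcompose_pCons by (simp only: algebra_simps)
  qed
  then show ?case using pCons by (metis dvd_add dvd_mult dvd_triv_left)
qed simp

definition orbit_sum :: "'a::comm_semiring_1 poly \<Rightarrow> nat \<Rightarrow> 'a poly \<Rightarrow> 'a poly" where
  "orbit_sum f n u = (\<Sum>i<n. u \<circ>\<^sub>p pcompose_iter f i)"

lemma orbit_sum_diff_pcompose: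
  "orbit_sum f n (u - u \<circ>\<^sub>p f) = u - u \<circ>\<^sub>p pcompose_iter f n"
  for f u :: "'a::comm_ring_1 poly"
proof -
  have "f \<circ>\<^sub>p pcompose_iter f i = pcompose_iter f (Suc i)" for i
    using pcompose_iter_add[of f 1 i] by (simp add: pcompose_pCons)
  then have "(u - u \<circ>\<^sub>p f) \<circ>\<^sub>p pcompose_iter f i
      = u \<circ>\<^sub>p pcompose_iter f i - u \<circ>\<^sub>p pcompose_iter f (Suc i)" for i
    by (metis pcompose_assoc pcompose_diff)
  then have "orbit_sum f n (u - u \<circ>\<^sub>p f)
      = (\<Sum>i<n. u \<circ>\<^sub>p pcompose_iter f i - u \<circ>\<^sub>p pcompose_iter f (Suc i))"
    by (simp only: orbit_sum_def)
  also have "\<dots> = u \<circ>\<^sub>p pcompose_iter f 0 - u \<circ>\<^sub>p pcompose_iter f n"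
    by (rule sum_lessThan_telescope')
  finally show ?thesis by simp
qed

text \<open>
  By telescoping, the orbit sum of every element of the image is divisible by
  \<open>pcompose_iter f n - x\<close>. Applied to all powers of \<open>g\<close>, this makes the power sums of the
  \<open>g \<circ> pcompose_iter f i\<close> vanish modulo that polynomial.
\<close>

lemma dvd_orbit_prod:
  fixes f g :: "'a::comm_ring_1 poly"
  assumes "\<And>m. m \<ge> 1 \<Longrightarrow> g ^ m \<in> range (\<lambda>u. u - u \<circ>\<^sub>p f)"
  shows "pcompose_iter f n - [:0, 1:] dvd of_nat n * (\<Prod>i<n. g \<circ>\<^sub>p pcompose_iter f i)"
proof -
  have "pcompose_iter f n - [:0, 1:] dvd (\<Sum>i<n. (g \<circ>\<^sub>p pcompose_iter f i) ^ m)" if m: "m \<ge> 1" for m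
  proof -
    obtain u where "g ^ m = u - u \<circ>\<^sub>p f" using assms[OF m] by blast
    then have "(\<Sum>i<n. (g \<circ>\<^sub>p pcompose_iter f i) ^ m) = - (u \<circ>\<^sub>p pcompose_iter f n - u)"
      using orbit_sum_diff_pcompose[of f n u]
      by (simp add: orbit_sum_def flip: pcompose_power)
    then show ?thesis using pcompose_minus_self_dvd by (simp only: dvd_minus_iff)
  qed
  then show ?thesis
    using dvd_power_sum_imp_dvd_prod[of "{..<n}" _ "\<lambda>i. g \<circ>\<^sub>p pcompose_iter f i"] by simp
qed

section \<open>Elements with all powers in the image\<close>

lemma linear_less_two_power:
  assumes "n \<ge> 2 * r + 2"
  shows "n * r < (2::nat) ^ n"
  using assms
proof (induction n rule: dec_induct)
  case base
  have "(r + 1) * r < 2 ^ (r + 1) * 2 ^ r"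
    by (intro mult_strict_mono less_exp) auto
  then show ?case by (simp add: power_add power_mult power2_eq_square mult_2 algebra_simps)
next
  case (step n)
  have "Suc n * r \<le> 2 * (n * r)" using step.hyps by (cases n) auto
  also have "\<dots> < 2 ^ Suc n" using step.IH by simp
  finally show ?case .
qed

text \<open>
  For \<open>g \<noteq> 0\<close>, the polynomial \<open>F = pcompose_iter f n - x\<close> has degree \<open>(deg f)\<^sup>n\<close>, yet divides a product of \<open>n\<close>
  factors each of which shares with \<open>F\<close> only divisors of degree at most \<open>deg g\<close>. Exponential growth
  beats linear growth.
\<close>

lemma powers_in_range_imp_0:
  fixes f g :: "'a::field poly"
  assumes p: "CHAR('a) > 0" and deg: "degree f \<ge> 2"
    and pow: "\<And>m. m \<ge> 1 \<Longrightarrow> g ^ m \<in> range (\<lambda>u. u - u \<circ>\<^sub>p f)"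
  shows "g = 0"
proof (rule ccontr)
  assume g: "g \<noteq> 0"
  \<comment> \<open>\<open>n\<close> is \<open>1\<close> in the field, and large enough for \<open>n \<cdot> deg g < 2\<^sup>n\<close>.\<close>
  define n where "n = CHAR('a) * (2 * degree g + 2) + 1"
  have "1 * (2 * degree g + 2) \<le> CHAR('a) * (2 * degree g + 2)"
    using p by (intro mult_right_mono) auto
  then have n: "n \<ge> 2 * degree g + 2" by (simp add: n_def)
  have of_nat_n: "(of_nat n :: 'a poly) = 1"
    by (simp add: n_def of_nat_poly)
  define F where "F = pcompose_iter f n - [:0, 1:]"
  have two: "2 ^ n \<le> degree (pcompose_iter f n)"
    using deg by (simp add: degree_pcompose_iter power_mono)
  have "(2::nat) ^ 1 \<le> 2 ^ n" using n by (intro power_increasing) auto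
  then have degF: "degree F = degree (pcompose_iter f n)"
    unfolding F_def diff_conv_add_uminus using two by (intro degree_add_eq_left) auto
  have "F \<noteq> 0"
  proof
    assume "F = 0"
    then show False using degF two by simp
  qed
  have "degree F \<le> card {..<n} * degree g"
  proof (rule degree_le_of_dvd_prod[OF _ \<open>F \<noteq> 0\<close>])
    show "F dvd (\<Prod>i<n. g \<circ>\<^sub>p pcompose_iter f i)"
      using dvd_orbit_prod[OF pow, of n] by (simp add: F_def of_nat_n)
    fix D i assume i: "i \<in> {..<n}" and D: "D dvd F" "D dvd g \<circ>\<^sub>p pcompose_iter f i"
    have "pcompose_iter f (n - i) \<circ>\<^sub>p pcompose_iter f i = pcompose_iter f n"
      using i pcompose_iter_add[of f "n - i" i] by simp
    then show "degree D \<le> degree g"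
      using degree_le_of_dvd_pcompose[of D "pcompose_iter f (n - i)" "pcompose_iter f i" g] D g
      by (simp add: F_def)
  qed simp
  then have "2 ^ n \<le> n * degree g" using two degF by simp
  then show False using linear_less_two_power[OF n] by simp
qed

text \<open>
  Here \<open>pcompose_iter f n - x\<close> is \<open>0\<close>, and what \<open>0\<close> divides is \<open>0\<close>.
\<close>

lemma powers_in_range_imp_0_of_periodic:
  fixes f g :: "'a::field poly"
  assumes iter: "pcompose_iter f n = [:0, 1:]" and n: "of_nat n \<noteq> (0 :: 'a)"
    and pow: "\<And>m. m \<ge> 1 \<Longrightarrow> g ^ m \<in> range (\<lambda>u. u - u \<circ>\<^sub>p f)"
  shows "g = 0"
proof -
  have "of_nat n * (\<Prod>i<n. g \<circ>\<^sub>p pcompose_iter f i) = 0"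
    using dvd_orbit_prod[OF pow, of n] by (simp add: iter)
  moreover have "(of_nat n :: 'a poly) \<noteq> 0" using n by (simp add: of_nat_poly)
  ultimately obtain i where i: "i < n" "g \<circ>\<^sub>p pcompose_iter f i = 0" by auto
  have "degree f ^ n = 1" using iter by (simp flip: degree_pcompose_iter)
  then have "degree f > 0" using i(1) by (cases "degree f") (auto simp: power_0_left)
  then have "degree (pcompose_iter f i) > 0" by (simp add: degree_pcompose_iter)
  then show ?thesis using i(2) by (simp add: pcompose_eq_0_iff)
qed

section \<open>Criteria for Mathieu-Zhao spaces\<close>

lemma Mathieu_Zhao_space_of_powers_imp_0:
  assumes "module.subspace smult M" "\<And>g. (\<And>m. m \<ge> 1 \<Longrightarrow> g ^ m \<in> M) \<Longrightarrow> g = 0"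
  shows "Mathieu_Zhao_space (M :: 'a::field poly set)"
  unfolding Mathieu_Zhao_space_def
proof (intro conjI allI impI)
  fix a b assume "\<forall>m\<ge>1. a ^ m \<in> M"
  then have "a = 0" using assms(2) by blast
  then have "b * a ^ m \<in> M" if "m \<ge> 1" for m
    using that poly_vs.subspace_0[OF assms(1)] by (simp add: power_0_left)
  then show "\<forall>\<^sub>F m in sequentially. b * a ^ m \<in> M"
    unfolding eventually_sequentially by blast
qed (rule assms(1))

lemma Mathieu_Zhao_space_of_ideal:
  assumes "module.subspace smult M" "\<And>u v. u \<in> M \<Longrightarrow> v * u \<in> M"
  shows "Mathieu_Zhao_space (M :: 'a::field poly set)"
  unfolding Mathieu_Zhao_space_def
  by (auto simp: assms eventually_sequentially intro!: exI[of _ 1])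

lemma Mathieu_Zhao_space_containing_1_eq_UNIV:
  assumes "Mathieu_Zhao_space M" "1 \<in> M"
  shows "M = UNIV"
proof (rule UNIV_eq_I[symmetric])
  fix b
  have "\<forall>m\<ge>1. 1 ^ m \<in> M" using assms(2) by simp
  then have "\<forall>\<^sub>F m in sequentially. b * 1 ^ m \<in> M"
    using assms(1) unfolding Mathieu_Zhao_space_def by blast
  then show "b \<in> M" by (simp add: eventually_const)
qed

section \<open>Affine maps with a fixed point\<close>

lemma power_CHAR_eq_1_iff:
  fixes x :: "'a::field"
  assumes "CHAR('a) > 0"
  shows "x ^ CHAR('a) = 1 \<longleftrightarrow> x = 1"
proof
  have prime: "prime CHAR('a)" using prime_CHAR_semidom[OF assms] .
  assume "x ^ CHAR('a) = 1"
  then have "1 = ((x - 1) + 1) ^ CHAR('a)" by simp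
  also have "\<dots> = (x - 1) ^ CHAR('a) + 1"
    by (subst freshmans_dream) (simp_all add: prime)
  finally show "x = 1" by simp
qed simp

text \<open>
  The least positive exponent \<open>t\<close> works: as \<open>p\<close>-th powers are injective in characteristic \<open>p\<close>, a
  factor \<open>p\<close> of \<open>t\<close> could be cancelled.
\<close>

lemma root_of_unity_exponent_not_dvd_char:
  fixes a :: "'a::field"
  assumes p: "CHAR('a) > 0" and "s \<ge> 1" "a ^ s = 1"
  obtains t where "of_nat t \<noteq> (0 :: 'a)" "a ^ t = 1"
proof -
  have prime: "prime CHAR('a)" using prime_CHAR_semidom[OF p] .
  define t where "t = (LEAST t. t \<ge> 1 \<and> a ^ t = 1)"
  have t: "t \<ge> 1" "a ^ t = 1"
    using LeastI[of "\<lambda>t. t \<ge> 1 \<and> a ^ t = 1" s] assms(2,3) by (auto simp: t_def)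
  have "of_nat t \<noteq> (0 :: 'a)"
  proof
    assume "of_nat t = (0 :: 'a)"
    then obtain k where k: "t = CHAR('a) * k" by (auto simp: of_nat_eq_0_iff_char_dvd)
    have "(a ^ k) ^ CHAR('a) = 1" using t(2) by (simp add: k power_mult[symmetric] mult.commute)
    then have "a ^ k = 1" by (simp add: power_CHAR_eq_1_iff p)
    moreover have "k \<ge> 1" using t(1) k by (cases k) auto
    ultimately have "t \<le> k" unfolding t_def by (intro Least_le) auto
    moreover have "2 * k \<le> t" unfolding k using prime_ge_2_nat[OF prime] by (rule mult_right_mono) simp
    ultimately show False using \<open>k \<ge> 1\<close> by simp
  qed
  then show thesis using that t by blast
qed

text \<open>
  The scalar \<open>b / (1 - a)\<close> is the fixed point of \<open>a x + b\<close>.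
\<close>

lemma pcompose_affine_eigenvector:
  fixes a b :: "'a::field"
  assumes "a \<noteq> 1"
  shows "[:- (b / (1 - a)), 1:] \<circ>\<^sub>p [:b, a:] = smult a [:- (b / (1 - a)), 1:]"
  using assms by (simp add: pcompose_pCons field_simps)

lemma pcompose_iter_affine_eq_self:
  fixes a b :: "'a::field"
  assumes "a \<noteq> 1" "a ^ n = 1"
  shows "pcompose_iter [:b, a:] n = [:0, 1:]"
proof -
  define c where "c = b / (1 - a)"
  have "[:- c, 1:] \<circ>\<^sub>p pcompose_iter [:b, a:] k = smult (a ^ k) [:- c, 1:]" for k
    by (induction k)
      (simp_all only: pcompose_iter.simps pcompose_assoc pcompose_smult
        pcompose_affine_eigenvector[OF assms(1), of b, folded c_def], simp_all add: mult.commute)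
  then have "[:- c, 1:] \<circ>\<^sub>p pcompose_iter [:b, a:] n = [:- c, 1:]"
    by (simp add: assms(2))
  then have "[:- c:] + pcompose_iter [:b, a:] n = [:- c:] + [:0, 1:]"
    by (simp add: pcompose_pCons)
  then show ?thesis by (rule add_left_imp_eq)
qed

text \<open>
  With \<open>c\<close> the fixed point, the operator acts on \<open>(x - c)\<^sup>n\<close> as multiplication by \<open>1 - a\<^sup>n\<close>, which is
  invertible for \<open>n \<ge> 1\<close>. So any polynomial without a constant term in its expansion around \<open>c\<close> can be
  divided term by term.
\<close>

lemma range_diff_pcompose_affine_eq:
  fixes a b :: "'a::field"
  assumes unity: "\<And>n. n \<ge> 1 \<Longrightarrow> a ^ n \<noteq> 1"
  shows "range (\<lambda>u. u - u \<circ>\<^sub>p [:b, a:]) = {u. poly u (b / (1 - a)) = 0}" (is "range ?\<delta> = ?J")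
proof (intro equalityI subsetI)
  have a: "a \<noteq> 1" using unity[of 1] by simp
  define c where "c = b / (1 - a)"
  have "b + c * a = c" using a by (simp add: c_def field_simps)
  then show "w \<in> ?J" if "w \<in> range ?\<delta>" for w
    using that by (auto simp: poly_pcompose simp flip: c_def)
  fix w assume "w \<in> ?J"
  interpret \<delta>: Vector_Spaces.linear smult smult ?\<delta> by (rule linear_diff_pcompose)
  define v where "v = w \<circ>\<^sub>p [:c, 1:]"
  define y where "y = [:- c, 1:]"
  have "y \<circ>\<^sub>p [:b, a:] = smult a y"
    unfolding y_def c_def by (rule pcompose_affine_eigenvector[OF a])
  then have eigen: "?\<delta> (y ^ n) = smult (1 - a ^ n) (y ^ n)" for n
    by (simp add: pcompose_power smult_power smult_diff_left)
  have v0: "coeff v 0 = 0"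
    using \<open>w \<in> ?J\<close> by (simp add: v_def c_def)
  have "w = v \<circ>\<^sub>p y"
    by (simp add: v_def y_def pcompose_assoc[symmetric] pcompose_pCons)
  also have "\<dots> = (\<Sum>n\<le>degree v. smult (coeff v n) (y ^ n))"
    by (subst poly_as_sum_of_monoms[of v, symmetric]) (simp only: pcompose_sum pcompose_monom)
  also have "\<dots> = (\<Sum>n\<le>degree v. smult (coeff v n / (1 - a ^ n)) (?\<delta> (y ^ n)))"
    unfolding eigen
  proof (intro sum.cong refl)
    fix n
    \<comment> \<open>For \<open>n = 0\<close> the quotient on the right is \<open>coeff v 0 / 0 = 0\<close>, which fits since \<open>coeff v 0 = 0\<close>.\<close>
    show "smult (coeff v n) (y ^ n) = smult (coeff v n / (1 - a ^ n)) (smult (1 - a ^ n) (y ^ n))"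
      using unity[of n] v0 by (cases "n = 0") auto
  qed
  also have "\<dots> = ?\<delta> (\<Sum>n\<le>degree v. smult (coeff v n / (1 - a ^ n)) (y ^ n))"
    by (simp only: \<delta>.sum \<delta>.scale)
  finally show "w \<in> range ?\<delta>" by blast
qed

lemma Mathieu_Zhao_space_affine:
  fixes a b :: "'a::field"
  assumes "CHAR('a) > 0" "a \<noteq> 1"
  shows "Mathieu_Zhao_space (range (\<lambda>u. u - u \<circ>\<^sub>p [:b, a:]))"
proof (cases "\<exists>s\<ge>1. a ^ s = 1")
  case True
  then obtain t where "of_nat t \<noteq> (0 :: 'a)" "a ^ t = 1"
    using root_of_unity_exponent_not_dvd_char[OF assms(1)] by blast
  then show ?thesis
    by (intro Mathieu_Zhao_space_of_powers_imp_0 subspace_range_diff_pcompose)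
      (rule powers_in_range_imp_0_of_periodic[OF pcompose_iter_affine_eq_self[OF assms(2)]])
next
  case False
  then show ?thesis
    by (intro Mathieu_Zhao_space_of_ideal subspace_range_diff_pcompose)
      (simp add: range_diff_pcompose_affine_eq)
qed

lemma not_locally_nilpotent_affine:
  fixes a b :: "'a::field"
  assumes "a \<noteq> 1"
  shows "\<not> locally_nilpotent (\<lambda>u. u - u \<circ>\<^sub>p [:b, a:])" (is "\<not> locally_nilpotent ?\<delta>")
proof
  define y where "y = [:- (b / (1 - a)), 1:]"
  have "(?\<delta> ^^ m) y = smult ((1 - a) ^ m) y" for m
    using pcompose_affine_eigenvector[OF assms, of b, folded y_def]
    by (induction m) (simp_all add: pcompose_smult smult_diff_left algebra_simps)
  moreover have "y \<noteq> 0" by (simp add: y_def)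
  moreover assume "locally_nilpotent ?\<delta>"
  then obtain m where "(?\<delta> ^^ m) y = 0" unfolding locally_nilpotent_def by blast
  ultimately show False using assms by auto
qed

section \<open>Maps of degree at least two\<close>

lemma not_locally_nilpotent_degree_ge_2:
  fixes f :: "'a::field poly"
  assumes "degree f \<ge> 2"
  shows "\<not> locally_nilpotent (\<lambda>u. u - u \<circ>\<^sub>p f)" (is "\<not> locally_nilpotent ?\<delta>")
proof
  have step: "degree (?\<delta> u) \<ge> 1" if "degree u \<ge> 1" for u
  proof -
    have "degree u * 1 < degree u * degree f"
      using that assms by (intro mult_strict_left_mono) auto
    then have "degree (- (u \<circ>\<^sub>p f) + u) = degree (- (u \<circ>\<^sub>p f))"
      by (intro degree_add_eq_left) (simp add: degree_pcompose)
    also have "- (u \<circ>\<^sub>p f) + u = ?\<delta> u" by simp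
    finally show ?thesis using that assms by (simp add: degree_pcompose)
  qed
  have "degree ((?\<delta> ^^ m) [:0, 1:]) \<ge> 1" for m
    by (induction m) (use step in auto)
  moreover assume "locally_nilpotent ?\<delta>"
  then obtain m where "(?\<delta> ^^ m) [:0, 1:] = 0" unfolding locally_nilpotent_def by blast
  ultimately show False by (metis degree_0 not_one_le_zero)
qed

section \<open>Translations\<close>

text \<open>
  A translation preserves the degree and the leading coefficient, so the difference lowers every positive
  degree; constants it sends to \<open>0\<close>.
\<close>

lemma locally_nilpotent_translation:
  "locally_nilpotent (\<lambda>u. u - u \<circ>\<^sub>p [:b, 1 :: 'a::field:])" (is "locally_nilpotent ?\<delta>")
proof -
  have lower: "degree (?\<delta> u) < degree u" if "degree u > 0" for u
  proof -
    have "lead_coeff (u \<circ>\<^sub>p [:b, 1:]) = lead_coeff u" by (subst lead_coeff_comp) auto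
    then have "coeff (?\<delta> u) (degree u) = 0" by (simp add: degree_pcompose)
    moreover have "degree (?\<delta> u) \<le> degree u"
      by (intro degree_diff_le) (simp_all add: degree_pcompose)
    ultimately show ?thesis
      using that by (metis eq_zero_or_degree_less degree_0)
  qed
  have "degree u < m \<Longrightarrow> (?\<delta> ^^ m) u = 0" for m u
  proof (induction m arbitrary: u)
    case (Suc m)
    show ?case
    proof (cases "degree u = 0")
      case True
      then obtain c where "u = [:c:]" using degree_eq_zeroE by blast
      moreover have "(?\<delta> ^^ m) 0 = 0" by (induction m) auto
      ultimately show ?thesis by (simp add: funpow_Suc_right del: funpow.simps)
    next
      case False
      then have "degree (?\<delta> u) < m" using lower[of u] Suc.prems by simp
      then have "(?\<delta> ^^ m) (?\<delta> u) = 0" by (rule Suc.IH)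
      then show ?thesis by (simp add: funpow_Suc_right del: funpow.simps)
    qed
  qed simp
  then have "(?\<delta> ^^ Suc (degree u)) u = 0" for u by blast
  then have "\<exists>m\<ge>1. (?\<delta> ^^ m) u = 0" for u
    by (metis One_nat_def Suc_le_mono le0)
  then show ?thesis
    unfolding locally_nilpotent_def using linear_diff_pcompose by blast
qed

lemma pcompose_iter_translation:
  "pcompose_iter [:b, 1 :: 'a::comm_semiring_1:] n = [:of_nat n * b, 1:]"
  by (induction n) (simp_all add: pcompose_pCons algebra_simps)

text \<open>
  The image contains \<open>1\<close>, so it would have to contain every polynomial. But the orbit sum of length
  \<open>p\<close> annihilates the image, because translating \<open>p\<close> times by \<open>b\<close> is the identity, while it takes at
  \<open>0\<close> a nonzero value on the polynomial \<open>w\<close> that vanishes at all the other points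
  \<open>b, 2 b, \<dots>, (p - 1) b\<close> of the orbit of \<open>0\<close>.
\<close>

lemma not_Mathieu_Zhao_space_translation:
  fixes b :: "'a::field"
  assumes char: "CHAR('a) > 0" and "b \<noteq> 0"
  shows "\<not> Mathieu_Zhao_space (range (\<lambda>u. u - u \<circ>\<^sub>p [:b, 1:]))" (is "\<not> Mathieu_Zhao_space ?M")
proof
  assume MZ: "Mathieu_Zhao_space ?M"
  have "1 = [:0, - 1 / b:] - [:0, - 1 / b:] \<circ>\<^sub>p [:b, 1:]"
    using \<open>b \<noteq> 0\<close> by (simp add: pcompose_pCons one_pCons)
  then have "1 \<in> ?M" by (rule range_eqI)
  with MZ have M: "?M = UNIV" by (rule Mathieu_Zhao_space_containing_1_eq_UNIV)
  define p where "p = CHAR('a)"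
  define w where "w = (\<Prod>i\<in>{1..<p}. [:- (of_nat i * b), 1:])"
  have "w \<in> ?M" by (subst M) (rule UNIV_I)
  then obtain u where u: "w = u - u \<circ>\<^sub>p [:b, 1:]" by (rule rangeE)
  have "orbit_sum [:b, 1:] p w = 0"
    unfolding u orbit_sum_diff_pcompose by (simp add: pcompose_iter_translation p_def)
  then have "0 = poly (orbit_sum [:b, 1:] p w) 0" by simp
  also have "\<dots> = (\<Sum>i<p. poly w (of_nat i * b))"
    by (simp add: orbit_sum_def poly_sum poly_pcompose pcompose_iter_translation)
  also have "\<dots> = poly w 0 + (\<Sum>i\<in>{..<p} - {0}. poly w (of_nat i * b))"
    using char by (subst sum.remove[of _ 0]) (auto simp: p_def)
  also have "(\<Sum>i\<in>{..<p} - {0}. poly w (of_nat i * b)) = 0"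
    by (intro sum.neutral ballI) (auto simp: w_def poly_prod intro!: prod_zero)
  finally have "poly w 0 = 0" by simp
  then obtain i where "i \<in> {1..<p}" "of_nat i * b = 0" by (auto simp: w_def poly_prod)
  then have "p dvd i" using \<open>b \<noteq> 0\<close> by (simp add: p_def of_nat_eq_0_iff_char_dvd)
  then show False using \<open>i \<in> {1..<p}\<close> by (auto dest: dvd_imp_le)
qed

section \<open>The characterization\<close>

theorem corollary2p6:
  fixes \<delta> :: "'a::field poly \<Rightarrow> 'a poly"
  assumes "CHAR('a) > 0"
    and "E_derivation \<delta>"
    and "\<delta> \<noteq> (\<lambda>_. 0)"
  shows "Mathieu_Zhao_space (range \<delta>) \<longleftrightarrow> \<not> locally_nilpotent \<delta>"
  using assms(2)
proof (cases rule: E_derivation_cases)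
  case id
  have "(\<delta> ^^ m) 1 = 1" for m by (induction m) (simp_all add: id)
  then have "\<not> locally_nilpotent \<delta>"
    unfolding locally_nilpotent_def by (metis one_neq_zero)
  moreover have "Mathieu_Zhao_space (range \<delta>)"
    by (rule Mathieu_Zhao_space_of_ideal) (simp_all add: id poly_vs.subspace_UNIV)
  ultimately show ?thesis by simp
next
  case (pcompose f)
  show ?thesis
  proof (cases "degree f \<ge> 2")
    case True
    have "Mathieu_Zhao_space (range \<delta>)"
      unfolding pcompose
      by (intro Mathieu_Zhao_space_of_powers_imp_0 subspace_range_diff_pcompose)
        (rule powers_in_range_imp_0[OF assms(1) True])
    then show ?thesis
      using not_locally_nilpotent_degree_ge_2[OF True] by (simp add: pcompose)
  next
    case False
    obtain b a where f: "f = [:b, a:]"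
    proof -
      have "f = [:coeff f 0, coeff f 1:]"
        by (rule poly_eqI) (use False in \<open>auto simp: coeff_pCons coeff_eq_0 split: nat.splits\<close>)
      then show thesis using that by blast
    qed
    show ?thesis
    proof (cases "a = 1")
      case True
      then have "b \<noteq> 0" using assms(3) pcompose f by auto
      then show ?thesis
        using not_Mathieu_Zhao_space_translation[OF assms(1)] locally_nilpotent_translation[of b]
        by (simp add: pcompose f True)
    next
      case False
      then show ?thesis
        using Mathieu_Zhao_space_affine[OF assms(1)] not_locally_nilpotent_affine
        by (simp add: pcompose f)
    qed
  qed
qed

end
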